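(* Let $N \ge 2$ be an integer with prime factorization $N = \prod_{p} p^{n_{N,p}}$ (product over all primes $p$), let $F(x) = f_1 x + f_2 x^2 \pmod N$ be a quadratic permutation polynomial over $\mathbb{Z}_N$, and let $f_2 = \prod_{p} p^{n_{F,p}}$ be the prime factorization of its second degree coefficient. Then $F(x)$ has at least one quadratic inverse polynomial if and only if all of the following hold: \[ n_{F,2} \ge \begin{cases} \max\left(\left\lceil \frac{n_{N,2}-2}{2}\right\rceil, 1\right) & \text{if } n_{N,2} > 1,\\ 0 & \text{if } n_{N,2} = 0,1,\end{cases} \] \[ n_{F,3} \ge \begin{cases} \max\left(\left\lceil \frac{n_{N,3}-1}{2}\right\rceil, 1\right) & \text{if } n_{N,3} > 0,\\ 0 & \text{if } n_{N,3} = 0,\end{cases} \] \[ n_{F,p} \ge \left\lceil \frac{n_{N,p}}{2} \right\rceil \quad \text{for every prime } p \ne 2,3. \]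
   Context: In the factorization $N=\prod_p p^{n_{N,p}}$ the exponents are non-negative integers, nonzero for only finitely many primes $p$; likewise for $f_2=\prod_p p^{n_{F,p}}$, where $f_2$ is a positive integer. A "quadratic polynomial" over $\mathbb{Z}_N$ means a polynomial of the form $h_1x+h_2x^2 \pmod N$ with non-negative integer coefficients (no constant term; $h_2 \equiv 0 \pmod N$ is not excluded). It is a permutation polynomial over $\mathbb{Z}_N$ if $x\mapsto h_1x+h_2x^2 \bmod N$ permutes $\{0,1,\dots,N-1\}$. A quadratic inverse polynomial of $F$ is a quadratic polynomial $G(x)=g_1x+g_2x^2 \pmod N$ such that $G(F(x))\equiv x \pmod N$ for all $x\in\{0,1,\dots,N-1\}$. *)

theory Defs
  imports "HOL-Number_Theory.Number_Theory"
begin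

(* Reduced value of h1 x + h2 x^2 modulo N: there is no constant term, and h2 may vanish modulo N. *)
definition quad_poly :: "nat \<Rightarrow> nat \<Rightarrow> nat \<Rightarrow> nat \<Rightarrow> nat" where
  "quad_poly N h1 h2 x = (h1 * x + h2 * x ^ 2) mod N"

definition quad_perm_poly :: "nat \<Rightarrow> nat \<Rightarrow> nat \<Rightarrow> bool" where
  "quad_perm_poly N h1 h2 \<longleftrightarrow> bij_betw (quad_poly N h1 h2) {0..<N} {0..<N}"

definition quad_inverse_poly :: "nat \<Rightarrow> nat \<Rightarrow> nat \<Rightarrow> nat \<Rightarrow> nat \<Rightarrow> bool" where
  "quad_inverse_poly N f1 f2 g1 g2 \<longleftrightarrow>
     (\<forall>x\<in>{0..<N}. [quad_poly N g1 g2 (quad_poly N f1 f2 x) = x] (mod N))"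

end

theory Submission
  imports Defs
begin

text \<open>
  A quadratic inverse exists iff \<open>N\<close> divides \<open>12 f\<^sub>2\<^sup>2\<close>. Over the Newton basis
  \<open>x\<close>, \<open>x(x-1)\<close>, \<open>x(x-1)(x-2)\<close>, \<open>x(x-1)(x-2)(x-3)\<close>, the first two coefficients of \<open>G(F(x)) - x\<close>
  determine \<open>g\<^sub>1\<close> and \<open>2 g\<^sub>2\<close> modulo \<open>N\<close>; the second one makes \<open>2 g\<^sub>2\<close> a unit multiple of
  \<open>2 f\<^sub>2\<close>, and the third one then becomes a unit multiple of \<open>12 f\<^sub>2\<^sup>2\<close>. The units come from the fact that
  for a permutation polynomial each prime \<open>p\<close> dividing \<open>N\<close> divides \<open>f\<^sub>2\<close> but not \<open>f\<^sub>1\<close>. The only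
  exception is \<open>p = 2\<close> for \<open>N \<equiv> 2 (mod 4)\<close>, where adding \<open>N/2\<close> to both coefficients
  does not change the function \<open>F\<close>.
\<close>

section \<open>Units modulo \<open>N\<close> and passage from residues to integers\<close>

text \<open>A prime dividing both \<open>n\<close> and \<open>a + f * m\<close> divides
  \<open>f\<close>, hence \<open>a\<close>, against coprimality. This makes every
  \<open>a + f * m\<close> invertible at once.\<close>

lemma coprime_add_mult_radical:
  fixes a f m n :: int
  assumes "\<And>p. prime p \<Longrightarrow> p dvd n \<Longrightarrow> p dvd f" "coprime a n" "n \<noteq> 0"
  shows "coprime (a + f * m) n"
proof (rule ccontr)
  assume "\<not> coprime (a + f * m) n"
  then obtain p where "prime p" and p: "p dvd a + f * m" "p dvd n"
    using prime_divisor_exists[of "gcd (a + f * m) n"] assms(3) by auto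
  moreover from this assms(1) have "p dvd f * m" by simp
  with p have "p dvd a" by (simp add: dvd_add_left_iff)
  ultimately show False using assms(2) by (meson coprime_common_divisor not_prime_unit)
qed

lemma quad_poly_cong:
  "[int (quad_poly N h1 h2 x) = int h1 * int x + int h2 * (int x)\<^sup>2] (mod int N)"
  by (simp add: quad_poly_def cong_def zmod_int)

text \<open>The condition depends only on \<open>x\<close> modulo \<open>N\<close>, so it extends to
  all integers, where subtraction and finite differences are available.\<close>

lemma quad_inverse_poly_iff:
  fixes N f1 f2 g1 g2 :: nat
  assumes "N > 0"
  shows "quad_inverse_poly N f1 f2 g1 g2 \<longleftrightarrow>
    (\<forall>x::int. int N dvd int g1 * (int f1 * x + int f2 * x\<^sup>2)
                        + int g2 * (int f1 * x + int f2 * x\<^sup>2)\<^sup>2 - x)"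
    (is "_ \<longleftrightarrow> (\<forall>x. _ dvd ?P x)")
proof -
  have val: "[quad_poly N g1 g2 (quad_poly N f1 f2 x) = x] (mod N) \<longleftrightarrow> int N dvd ?P (int x)" for x
  proof -
    let ?y = "int (quad_poly N f1 f2 x)" and ?F = "int f1 * int x + int f2 * (int x)\<^sup>2"
    have "[int (quad_poly N g1 g2 (quad_poly N f1 f2 x)) = int g1 * ?y + int g2 * ?y\<^sup>2] (mod int N)"
      by (rule quad_poly_cong)
    also have "[int g1 * ?y + int g2 * ?y\<^sup>2 = int g1 * ?F + int g2 * ?F\<^sup>2] (mod int N)"
      by (intro cong_add cong_mult cong_pow cong_refl quad_poly_cong)
    finally have "[int (quad_poly N g1 g2 (quad_poly N f1 f2 x)) = int x] (mod int N) \<longleftrightarrow>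
        [int g1 * ?F + int g2 * ?F\<^sup>2 = int x] (mod int N)"
      by (simp add: cong_def)
    then show ?thesis
      by (simp only: cong_int_iff flip: cong_iff_dvd_diff)
  qed
  have shift: "int N dvd ?P x \<longleftrightarrow> int N dvd ?P (x mod int N)" for x
  proof -
    have "[?P (x mod int N) = ?P x] (mod int N)"
      by (intro cong_add cong_diff cong_mult cong_pow cong_refl) (simp_all add: cong_def)
    then show ?thesis by (simp add: cong_dvd_iff)
  qed
  show ?thesis
  proof
    assume inv: "quad_inverse_poly N f1 f2 g1 g2"
    show "\<forall>x. int N dvd ?P x"
    proof
      fix x :: int
      have "nat (x mod int N) \<in> {0..<N}" using assms by (simp add: nat_less_iff)
      with inv val have "int N dvd ?P (int (nat (x mod int N)))"
        unfolding quad_inverse_poly_def by blast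
      with assms show "int N dvd ?P x" by (subst shift) simp
    qed
  next
    assume "\<forall>x. int N dvd ?P x"
    with val show "quad_inverse_poly N f1 f2 g1 g2" unfolding quad_inverse_poly_def by blast
  qed
qed

section \<open>Necessity of the divisibility\<close>

lemma quad_inverse_poly_imp_dvd:
  fixes N f1 f2 g1 g2 :: nat
  assumes N: "N > 0"
    and inv: "quad_inverse_poly N f1 f2 g1 g2"
    and cop: "\<And>m. coprime (int f1 + int f2 * m) (int N)"
  shows "N dvd 12 * f2\<^sup>2"
proof -
  define n a f g h where "n = int N" and "a = int f1" and "f = int f2" and "g = int g1" and "h = int g2"
  note [simp] = n_def[symmetric] a_def[symmetric] f_def[symmetric] g_def[symmetric] h_def[symmetric]
  have P: "n dvd g * (a * x + f * x\<^sup>2) + h * (a * x + f * x\<^sup>2)\<^sup>2 - x" for x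
    using inv quad_inverse_poly_iff[OF N] by simp
  define P where "P x = g * (a * x + f * x\<^sup>2) + h * (a * x + f * x\<^sup>2)\<^sup>2 - x" for x
  have dP: "n dvd P x" for x using P unfolding P_def .
  \<comment> \<open>This is the third difference of \<open>P\<close> at 0, since
    \<open>P 0 = 0\<close>; it kills the linear and quadratic terms.\<close>
  have "n dvd P 3 - 3 * P 2 + 3 * P 1" using dP by (intro dvd_add dvd_diff dvd_mult)
  also have "P 3 - 3 * P 2 + 3 * P 1 = 12 * h * f * (a + f * 3)"
    unfolding P_def by (simp add: algebra_simps power2_eq_square)
  finally have third: "n dvd 12 * h * f"
    using cop[of 3] by (simp add: coprime_dvd_mult_left_iff coprime_commute)
  \<comment> \<open>The inner combination of \<open>P 1\<close> and \<open>P 2\<close> eliminates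
    \<open>g\<close>, leaving \<open>2 * f\<close> plus a multiple of \<open>2 * h\<close>. The
    factor \<open>6 * f\<close> turns the latter into a multiple of \<open>12 * h * f\<close>,
    already known to vanish modulo \<open>n\<close>.\<close>
  have "n dvd 6 * f * ((a + f) * (P 2 - 2 * P 1) - 2 * f * P 1)
          - 12 * h * f * (a + f) * (a\<^sup>2 + 5 * a * f + 6 * f\<^sup>2)"
    using dP third by (intro dvd_diff dvd_mult[of n _ "6 * f"]) (auto intro!: dvd_mult2 dvd_mult dvd_diff)
  also have "\<dots> = 12 * f\<^sup>2"
    unfolding P_def by (simp add: algebra_simps power2_eq_square)
  finally have "int N dvd int (12 * f2\<^sup>2)" by simp
  then show ?thesis by (simp only: int_dvd_int_iff)
qed

section \<open>Sufficiency: construction of the inverse\<close>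

text \<open>These factors can be moved onto the Newton coefficients, which therefore need not vanish
  modulo \<open>N\<close> themselves.\<close>

lemma dvd_falling_factorials:
  fixes x :: int
  shows "2 dvd x * (x - 1)" "6 dvd x * (x - 1) * (x - 2)" "12 dvd x * (x - 1) * (x - 2) * (x - 3)"
proof -
  show two: "2 dvd x * (x - 1)" by simp
  have "x mod 3 = 0 \<or> x mod 3 = 1 \<or> x mod 3 = 2" by presburger
  then have "3 dvd x \<or> 3 dvd x - 1 \<or> 3 dvd x - 2" by presburger
  then have three: "3 dvd x * (x - 1) * (x - 2)" by (auto intro: dvd_mult dvd_mult2)
  have "2 dvd x * (x - 1) * (x - 2)" using two by (rule dvd_mult2)
  with three have "3 * 2 dvd x * (x - 1) * (x - 2)" by (intro divides_mult) simp_all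
  then show "6 dvd x * (x - 1) * (x - 2)" by simp
  have "2 * 2 dvd (x * (x - 1)) * ((x - 2) * (x - 3))"
    by (intro mult_dvd_mono) simp_all
  then have "4 dvd x * (x - 1) * (x - 2) * (x - 3)" by (simp add: mult.assoc)
  moreover have "3 dvd x * (x - 1) * (x - 2) * (x - 3)" using three by (rule dvd_mult2)
  moreover have three_four: "coprime 3 (4::int)"
    using coprime_add_one_right[of "3::int"] by simp
  ultimately have "3 * 4 dvd x * (x - 1) * (x - 2) * (x - 3)"
    by (intro divides_mult) (simp_all add: three_four)
  then show "12 dvd x * (x - 1) * (x - 2) * (x - 3)" by simp
qed

lemma dvd_imp_quad_inverse_poly:
  fixes N f1 f2 :: nat
  assumes N: "N > 0"
    and dvd: "N dvd 12 * f2\<^sup>2"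
    and cop: "\<And>m. coprime (int f1 + int f2 * m) (int N)"
  shows "\<exists>g1 g2. quad_inverse_poly N f1 f2 g1 g2"
proof -
  define n a f where "n = int N" and "a = int f1" and "f = int f2"
  have n: "n > 0" using N n_def by simp
  have "int N dvd int (12 * f2\<^sup>2)" using dvd by (simp only: int_dvd_int_iff)
  then have dvd': "n dvd 12 * f\<^sup>2" by (simp add: n_def f_def)
  \<comment> \<open>Eliminating \<open>g\<close> from \<open>G(F(2)) = 2\<close> leaves
    \<open>2 * h * (a^2 + 5 * a * f + 6 * f^2) = - 2 * f / (a + f)\<close>. Up to multiples of
    \<open>12 * h * f\<close> the left side is \<open>2 * h * a * (a - f)\<close>, hence the factor
    \<open>a - f\<close>.\<close>
  have "coprime (a * (a + f) * (a - f)) n"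
    using cop[of 0] cop[of 1] cop[of "-1"] by (simp add: n_def a_def f_def)
  then obtain u where "[a * (a + f) * (a - f) * u = 1] (mod n)"
    by (metis cong_solve_coprime_int)
  then have u: "n dvd a * (a + f) * (a - f) * u - 1" by (simp add: cong_iff_dvd_diff)
  \<comment> \<open>\<open>u * a * (a - f)\<close> is the inverse of \<open>F(1) = a + f\<close>, so \<open>g\<close> is the solution of \<open>G(F(1)) = 1\<close>;
    \<open>h\<close> then solves \<open>G(F(2)) = 2\<close>, up to a multiple of \<open>12 * h * f\<close>.\<close>
  define h where "h = (- u * f) mod n"
  define g where "g = (u * a * (a - f) - h * (a + f)) mod n"
  have h: "n dvd h + u * f" unfolding h_def
    by (metis cong_iff_dvd_diff cong_mod_left cong_refl diff_minus_eq_add mult_minus_left)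
  have g: "n dvd g - (u * a * (a - f) - h * (a + f))" unfolding g_def
    by (metis cong_iff_dvd_diff cong_mod_left cong_refl)
  have hf: "n dvd 12 * (h * f)"
  proof -
    have "12 * (h * f) = 12 * f * (h + u * f) - 12 * f\<^sup>2 * u"
      by (simp add: algebra_simps power2_eq_square)
    moreover have "n dvd \<dots>" by (intro dvd_diff dvd_mult[OF h] dvd_mult2[OF dvd'])
    ultimately show ?thesis by simp
  qed
  define c1 where "c1 = g * (a + f) + h * (a + f)\<^sup>2 - 1"
  define c2 where "c2 = g * f + h * a\<^sup>2 + 6 * h * a * f + 7 * h * f\<^sup>2"
  have c1: "n dvd c1"
  proof -
    have "c1 = (g - (u * a * (a - f) - h * (a + f))) * (a + f) + (a * (a + f) * (a - f) * u - 1)"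
      by (simp add: c1_def algebra_simps power2_eq_square)
    moreover have "n dvd \<dots>" using g u by (intro dvd_add dvd_mult2)
    ultimately show ?thesis by simp
  qed
  \<comment> \<open>The factor 2 is harmless: \<open>c2\<close> is the coefficient of the even
    number \<open>x * (x - 1)\<close>.\<close>
  have c2: "n dvd 2 * c2"
  proof -
    have "2 * c2 = 2 * f * (g - (u * a * (a - f) - h * (a + f))) + 2 * a * (a - f) * (h + u * f)
        + 12 * (h * f) * (a + f)"
      by (simp add: c2_def algebra_simps power2_eq_square)
    moreover have "n dvd \<dots>" by (intro dvd_add dvd_mult[OF g] dvd_mult[OF h] dvd_mult2[OF hf])
    ultimately show ?thesis by simp
  qed
  have "n dvd g * (a * x + f * x\<^sup>2) + h * (a * x + f * x\<^sup>2)\<^sup>2 - x" for x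
  proof -
    obtain k2 k3 k4 where k: "x * (x - 1) = 2 * k2" "x * (x - 1) * (x - 2) = 6 * k3"
      "x * (x - 1) * (x - 2) * (x - 3) = 12 * k4"
      using dvd_falling_factorials[of x] unfolding dvd_def by blast
    have "g * (a * x + f * x\<^sup>2) + h * (a * x + f * x\<^sup>2)\<^sup>2 - x
        = c1 * x + c2 * (x * (x - 1)) + 2 * (h * f) * (a + 3 * f) * (x * (x - 1) * (x - 2))
          + h * f * f * (x * (x - 1) * (x - 2) * (x - 3))"
      by (simp add: c1_def c2_def algebra_simps power2_eq_square)
    also have "\<dots> = c1 * x + 2 * c2 * k2 + 12 * (h * f) * ((a + 3 * f) * k3) + 12 * (h * f) * (f * k4)"
      \<comment> \<open>The longest product goes first, because each shorter one is a subterm of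
        it.\<close>
      unfolding k(3) unfolding k(2) unfolding k(1) by (simp add: algebra_simps)
    also have "n dvd \<dots>" by (intro dvd_add dvd_mult2[OF c1] dvd_mult2[OF c2] dvd_mult2[OF hf])
    finally show ?thesis .
  qed
  moreover have "g = int (nat g)" "h = int (nat h)" using n by (simp_all add: g_def h_def)
  ultimately have "quad_inverse_poly N f1 f2 (nat g) (nat h)"
    unfolding quad_inverse_poly_iff[OF N] n_def a_def f_def by metis
  then show ?thesis by blast
qed

section \<open>Permutation polynomials modulo divisors of \<open>N\<close>\<close>

text \<open>Surjectivity passes to a divisor \<open>d\<close>: a preimage modulo \<open>N\<close>
  reduces to one modulo \<open>d\<close>. On a finite set it gives injectivity.\<close>

lemma quad_perm_poly_inj_mod:
  fixes N f1 f2 d :: nat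
  assumes "quad_perm_poly N f1 f2" "d dvd N" "N > 0"
  shows "inj_on (\<lambda>x. (f1 * x + f2 * x\<^sup>2) mod d) {0..<d}"
proof -
  have d: "d > 0" "d \<le> N" using assms by (auto simp: dvd_imp_le dvd_pos_nat)
  have "{0..<d} \<subseteq> (\<lambda>x. (f1 * x + f2 * x\<^sup>2) mod d) ` {0..<d}"
  proof
    fix y assume y: "y \<in> {0..<d}"
    with d have "y \<in> {0..<N}" by simp
    with assms(1) obtain x where "quad_poly N f1 f2 x = y"
      unfolding quad_perm_poly_def bij_betw_def by (metis imageE)
    then have "(f1 * x + f2 * x\<^sup>2) mod d = y"
      using y assms(2) by (metis quad_poly_def mod_mod_cancel atLeastLessThan_iff mod_less)
    moreover have "[f1 * (x mod d) + f2 * (x mod d)\<^sup>2 = f1 * x + f2 * x\<^sup>2] (mod d)"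
      by (intro cong_add cong_mult cong_pow cong_refl) (simp_all add: cong_def)
    ultimately have "y = (f1 * (x mod d) + f2 * (x mod d)\<^sup>2) mod d"
      by (simp add: cong_def)
    then show "y \<in> (\<lambda>x. (f1 * x + f2 * x\<^sup>2) mod d) ` {0..<d}"
      by (rule image_eqI) (use d in simp)
  qed
  then have "(\<lambda>x. (f1 * x + f2 * x\<^sup>2) mod d) ` {0..<d} = {0..<d}" using d by auto
  then show ?thesis by (intro eq_card_imp_inj_on) simp_all
qed

text \<open>Serves to refute by collisions: incongruent arguments cannot have congruent values
  modulo a divisor of \<open>N\<close>.\<close>

lemma quad_perm_poly_cong_imp_cong:
  fixes N f1 f2 d :: nat
  assumes "quad_perm_poly N f1 f2" "d dvd N" "N > 0"
    and "[f1 * x + f2 * x\<^sup>2 = f1 * y + f2 * y\<^sup>2] (mod d)"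
  shows "[x = y] (mod d)"
proof -
  have d: "d > 0" using assms by (auto simp: dvd_pos_nat)
  have red: "[f1 * (z mod d) + f2 * (z mod d)\<^sup>2 = f1 * z + f2 * z\<^sup>2] (mod d)" for z
    by (intro cong_add cong_mult cong_pow cong_refl) (simp_all add: cong_def)
  have "[f1 * (x mod d) + f2 * (x mod d)\<^sup>2 = f1 * (y mod d) + f2 * (y mod d)\<^sup>2] (mod d)"
    using red[of x] red[of y] assms(4) by (simp add: cong_def)
  then have "x mod d = y mod d"
    using inj_onD[OF quad_perm_poly_inj_mod[OF assms(1-3)], of "x mod d" "y mod d"] d
    by (simp add: cong_def)
  then show ?thesis by (simp add: cong_def)
qed

text \<open>Suppose \<open>p\<close> does not divide \<open>f2\<close>. If \<open>p\<close> divides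
  \<open>f1\<close>, then 1 and -1 (written \<open>p - 1\<close>) collide; otherwise 0 collides with
  the nonzero root of the polynomial.\<close>

lemma quad_perm_poly_odd_prime:
  fixes N f1 f2 p :: nat
  assumes perm: "quad_perm_poly N f1 f2" and N: "N > 0" and p: "prime p" "p dvd N" "p \<noteq> 2"
  shows "p dvd f2"
proof (rule ccontr)
  assume nd: "\<not> p dvd f2"
  note inj = quad_perm_poly_cong_imp_cong[OF perm p(2) N]
  have p3: "p > 2" using p prime_ge_2_nat[of p] by linarith
  show False
  proof (cases "p dvd f1")
    case True
    obtain k where "p = k + 2" using p3 by (metis less_imp_add_positive add.commute)
    then have "(p - 1)\<^sup>2 = 1 + p * k" by (simp add: algebra_simps power2_eq_square)
    then have "[(p - 1)\<^sup>2 = 1] (mod p)" by (simp only: cong_def mod_mult_self2)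
    then have "[f2 * (p - 1)\<^sup>2 = f2 * 1\<^sup>2] (mod p)" by (intro cong_mult cong_refl) simp
    moreover have "[f1 * (p - 1) = f1 * 1] (mod p)" using True by (simp add: cong_def mod_eq_0_iff_dvd)
    ultimately have "[f1 * (p - 1) + f2 * (p - 1)\<^sup>2 = f1 * 1 + f2 * 1\<^sup>2] (mod p)"
      by (intro cong_add)
    from inj[OF this] p3 show False by (simp add: cong_def)
  next
    case False
    have "coprime f2 p" using nd p(1) by (metis coprime_commute prime_imp_coprime)
    then obtain u where u: "[f2 * u = 1] (mod p)" by (metis cong_solve_coprime_nat One_nat_def)
    \<comment> \<open>the root \<open>- f1 / f2\<close>\<close>
    define x where "x = u * f1 * (p - 1)"
    have "[f2 * u * f1 * (p - 1) + f1 = 1 * f1 * (p - 1) + f1] (mod p)"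
      using u by (intro cong_add cong_mult cong_refl)
    also have "1 * f1 * (p - 1) + f1 = f1 * p"
      using p3 by (cases p) simp_all
    finally have "p dvd f2 * x + f1"
      by (simp add: x_def cong_def mod_eq_0_iff_dvd mult.assoc)
    then have "p dvd x * (f2 * x + f1)" by (rule dvd_mult)
    then have "[f1 * x + f2 * x\<^sup>2 = f1 * 0 + f2 * 0\<^sup>2] (mod p)"
      by (simp add: cong_def mod_eq_0_iff_dvd algebra_simps power2_eq_square)
    from inj[OF this] have "p dvd x" by (simp add: cong_def mod_eq_0_iff_dvd)
    with \<open>p dvd f2 * x + f1\<close> False show False by (metis dvd_add_right_iff dvd_mult)
  qed
qed

text \<open>Otherwise 0 and 1 would collide modulo \<open>p\<close>.\<close>

lemma quad_perm_poly_prime_not_dvd_sum: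
  fixes N f1 f2 p :: nat
  assumes "quad_perm_poly N f1 f2" "N > 0" "prime p" "p dvd N"
  shows "\<not> p dvd f1 + f2"
proof
  assume "p dvd f1 + f2"
  then have "[f1 * 1 + f2 * 1\<^sup>2 = f1 * 0 + f2 * 0\<^sup>2] (mod p)" by (simp add: cong_def mod_eq_0_iff_dvd)
  from quad_perm_poly_cong_imp_cong[OF assms(1,4,2) this] assms(3) show False
    by (simp add: cong_def mod_eq_0_iff_dvd)
qed

text \<open>If \<open>f2\<close> is odd, then \<open>f1\<close> is even, and 0 and 2 collide modulo
  4.\<close>

lemma quad_perm_poly_four_dvd:
  fixes N f1 f2 :: nat
  assumes "quad_perm_poly N f1 f2" "N > 0" "4 dvd N"
  shows "even f2"
proof (rule ccontr)
  assume "odd f2"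
  moreover have "2 dvd N" using assms(3) by presburger
  then have "odd (f1 + f2)" using quad_perm_poly_prime_not_dvd_sum[OF assms(1,2) two_is_prime_nat] by simp
  ultimately obtain k where "f1 = 2 * k" by auto
  then have "[f1 * 2 + f2 * 2\<^sup>2 = f1 * 0 + f2 * 0\<^sup>2] (mod 4)" by (simp add: cong_def)
  from quad_perm_poly_cong_imp_cong[OF assms(1,3,2) this] show False by (simp add: cong_def)
qed

section \<open>Normal form and the divisibility criterion\<close>

text \<open>In the exceptional case \<open>N = 2 * M\<close> with \<open>M\<close> and
  \<open>f2\<close> odd, adding \<open>M\<close> to both coefficients adds
  \<open>M * (x * (x + 1))\<close>, a multiple of \<open>N\<close>. It makes the quadratic
  coefficient even and keeps its divisibility by the odd primes dividing \<open>N\<close>.\<close>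

lemma quad_perm_poly_normal_form:
  fixes N f1 f2 :: nat
  assumes perm: "quad_perm_poly N f1 f2" and N: "N > 0"
  obtains h1 h2 where "quad_poly N h1 h2 = quad_poly N f1 f2"
    and "\<And>p. prime p \<Longrightarrow> p dvd N \<Longrightarrow> p dvd h2"
    and "N dvd 12 * h2\<^sup>2 \<longleftrightarrow> N dvd 12 * f2\<^sup>2"
proof (cases "even N \<and> odd f2")
  case False
  then have "\<And>p. prime p \<Longrightarrow> p dvd N \<Longrightarrow> p dvd f2"
    using quad_perm_poly_odd_prime[OF perm N] by metis
  then show thesis using that by blast
next
  case True
  then have "\<not> 4 dvd N" using quad_perm_poly_four_dvd[OF perm N] by blast
  from True obtain M where M: "N = 2 * M" by auto
  with \<open>\<not> 4 dvd N\<close> have oM: "odd M" by auto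
  show thesis
  proof (rule that[of "f1 + M" "f2 + M"])
    show "quad_poly N (f1 + M) (f2 + M) = quad_poly N f1 f2"
    proof
      fix x :: nat
      have "even (x * (x + 1))" by simp
      then obtain k where k: "x * (x + 1) = 2 * k" by (rule evenE)
      have "(f1 + M) * x + (f2 + M) * x\<^sup>2 = f1 * x + f2 * x\<^sup>2 + M * (x * (x + 1))"
        by (simp add: algebra_simps power2_eq_square)
      also have "\<dots> = f1 * x + f2 * x\<^sup>2 + N * k" unfolding k M by simp
      finally show "quad_poly N (f1 + M) (f2 + M) x = quad_poly N f1 f2 x"
        by (simp add: quad_poly_def)
    qed
    show "p dvd f2 + M" if "prime p" "p dvd N" for p
    proof (cases "p = 2")
      case False
      with that have "p dvd M" unfolding M
        by (metis prime_dvd_mult_iff primes_dvd_imp_eq two_is_prime_nat)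
      then show ?thesis using quad_perm_poly_odd_prime[OF perm N that False] by simp
    qed (use oM True in simp)
    have "12 * (f2 + M)\<^sup>2 = 12 * f2\<^sup>2 + N * (12 * f2 + 6 * M)"
      by (simp add: M algebra_simps power2_eq_square)
    then show "N dvd 12 * (f2 + M)\<^sup>2 \<longleftrightarrow> N dvd 12 * f2\<^sup>2"
      by (simp add: dvd_add_left_iff)
  qed
qed

text \<open>Having an inverse depends only on the function, so the coefficients may be replaced by
  the normal form, where all \<open>h1 + h2 * m\<close> are units.\<close>

lemma quad_inverse_poly_exists_iff_dvd:
  fixes N f1 f2 :: nat
  assumes perm: "quad_perm_poly N f1 f2" and N: "N > 0"
  shows "(\<exists>g1 g2. quad_inverse_poly N f1 f2 g1 g2) \<longleftrightarrow> N dvd 12 * f2\<^sup>2"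
proof -
  obtain h1 h2 where eq: "quad_poly N h1 h2 = quad_poly N f1 f2"
    and rad: "\<And>p. prime p \<Longrightarrow> p dvd N \<Longrightarrow> p dvd h2"
    and dvd: "N dvd 12 * h2\<^sup>2 \<longleftrightarrow> N dvd 12 * f2\<^sup>2"
    using quad_perm_poly_normal_form[OF perm N] by blast
  from perm eq have perm': "quad_perm_poly N h1 h2" by (simp add: quad_perm_poly_def)
  have "\<not> p dvd h1" if "prime p" "p dvd N" for p
    using quad_perm_poly_prime_not_dvd_sum[OF perm' N that] rad[OF that] by (meson dvd_add)
  then have "coprime h1 N" by (metis coprime_iff_gcd_eq_1 gcd_dvd1 gcd_dvd2 dvd_trans prime_factor_nat)
  then have c: "coprime (int h1) (int N)" by simp
  have rad': "p dvd int h2" if p: "prime p" "p dvd int N" for p :: int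
  proof -
    obtain q where q: "p = int q" using prime_ge_0_int[OF p(1)] zero_le_imp_eq_int by blast
    with p rad show ?thesis by simp
  qed
  have cop: "coprime (int h1 + int h2 * m) (int N)" for m
    using N by (intro coprime_add_mult_radical rad' c) auto
  have "(\<exists>g1 g2. quad_inverse_poly N f1 f2 g1 g2) \<longleftrightarrow> (\<exists>g1 g2. quad_inverse_poly N h1 h2 g1 g2)"
    by (simp add: quad_inverse_poly_def eq)
  also have "\<dots> \<longleftrightarrow> N dvd 12 * h2\<^sup>2"
    using quad_inverse_poly_imp_dvd[OF N _ cop] dvd_imp_quad_inverse_poly[OF N _ cop] by blast
  finally show ?thesis using dvd by simp
qed

section \<open>Translation into prime exponents\<close>

lemma dvd_iff_multiplicity_le:
  fixes a b :: nat
  assumes "a \<noteq> 0" "b \<noteq> 0"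
  shows "a dvd b \<longleftrightarrow> (\<forall>p. prime p \<longrightarrow> multiplicity p a \<le> multiplicity p b)"
  using assms by (auto intro: dvd_imp_multiplicity_le multiplicity_le_imp_dvd)

lemma multiplicity_12:
  fixes p :: nat
  assumes "prime p"
  shows "multiplicity p 12 = (if p = 2 then 2 else if p = 3 then 1 else 0)"
proof -
  have "multiplicity p (2 ^ 2 * 3) = 2 * multiplicity p 2 + multiplicity p 3"
    using assms by (subst prime_elem_multiplicity_mult_distrib) (simp_all only: prime_elem_multiplicity_power_distrib prime_imp_prime_elem, simp_all)
  then have "multiplicity p 12 = 2 * multiplicity p 2 + multiplicity p 3" by simp
  moreover have "multiplicity p 2 = (if p = 2 then 1 else 0)" "multiplicity p 3 = (if p = 3 then 1 else 0)"
    using assms by (auto simp: prime_multiplicity_other)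
  ultimately show ?thesis by simp
qed

lemma dvd_12_square_iff:
  fixes N f :: nat
  assumes "N > 0" "f > 0"
  shows "N dvd 12 * f\<^sup>2 \<longleftrightarrow>
    multiplicity 2 N \<le> 2 + 2 * multiplicity 2 f \<and>
    multiplicity 3 N \<le> 1 + 2 * multiplicity 3 f \<and>
    (\<forall>p. prime p \<and> p \<noteq> 2 \<and> p \<noteq> 3 \<longrightarrow> multiplicity p N \<le> 2 * multiplicity p f)"
proof -
  have "multiplicity p (12 * f\<^sup>2) = (if p = 2 then 2 else if p = 3 then 1 else 0) + 2 * multiplicity p f"
    if "prime p" for p
    using that assms multiplicity_12[OF that]
    by (simp add: prime_elem_multiplicity_mult_distrib prime_elem_multiplicity_power_distrib)
  moreover have "prime (2::nat)" "prime (3::nat)" by simp_all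
  ultimately show ?thesis
    using assms by (subst dvd_iff_multiplicity_le) (auto split: if_splits)
qed

theorem theorem3p6:
  fixes N f1 f2 :: nat
  assumes "N \<ge> 2"
    and "f2 > 0"
    and "quad_perm_poly N f1 f2"
  shows "(\<exists>g1 g2. quad_inverse_poly N f1 f2 g1 g2) \<longleftrightarrow>
    (int (multiplicity 2 f2) \<ge>
       (if multiplicity 2 N > 1 then max \<lceil>(real (multiplicity 2 N) - 2) / 2\<rceil> 1 else 0)) \<and>
    (int (multiplicity 3 f2) \<ge>
       (if multiplicity 3 N > 0 then max \<lceil>(real (multiplicity 3 N) - 1) / 2\<rceil> 1 else 0)) \<and>
    (\<forall>p::nat. prime p \<and> p \<noteq> 2 \<and> p \<noteq> 3 \<longrightarrow>
       int (multiplicity p f2) \<ge> \<lceil>real (multiplicity p N) / 2\<rceil>)"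
proof -
  have N: "N > 0" using assms(1) by simp
  have pos: "multiplicity p f2 \<ge> 1" if "prime p" "p dvd f2" for p
    using that assms(2) by (simp add: prime_multiplicity_gt_zero_iff Suc_le_eq)
  \<comment> \<open>The lower bound 1 inside both maxima is automatic for a permutation polynomial;
    the ceilings alone express \<open>N dvd 12 * f2^2\<close>.\<close>
  have two: "multiplicity 2 f2 \<ge> 1" if "multiplicity 2 N > 1"
  proof -
    have "2 ^ 2 dvd N" using that by (intro multiplicity_dvd') simp
    then show ?thesis using quad_perm_poly_four_dvd[OF assms(3) N] pos by simp
  qed
  have three: "multiplicity 3 f2 \<ge> 1" if "multiplicity 3 N > 0"
  proof -
    have "3 dvd N" using that by (metis not_dvd_imp_multiplicity_0 less_irrefl)
    then show ?thesis using quad_perm_poly_odd_prime[OF assms(3) N, of 3] pos by simp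
  qed
  \<comment> \<open>The offset \<open>j\<close> is the exponent of the prime in 12: 2, 1 or 0.
    Subtraction is real, so \<open>m < j\<close> is covered too.\<close>
  have ceil: "\<lceil>(real m - real j) / 2\<rceil> \<le> int k \<longleftrightarrow> m \<le> j + 2 * k" for m j k
    by (simp add: ceiling_le_iff field_simps) linarith
  show ?thesis
    unfolding quad_inverse_poly_exists_iff_dvd[OF assms(3) N] dvd_12_square_iff[OF N assms(2)]
    using two three ceil[of _ 2] ceil[of _ 1] ceil[of _ 0] by auto
qed

end
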